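(* Let $(X,d)$ be a premetric space and let $(\widehat{X},\widehat{d})$ be the premetric space of equivalence classes of Cauchy families on $X$. The function $i:X\to\widehat{X}$ defined by $i(x)=x^*$, the equivalence class of the Cauchy family $\{\{x\}\}$, is an isometric embedding with dense image.
   Context: A premetric on a nonempty set $X$ is a relation $d$ between $X\times X$ and the nonnegative rationals, written $d(x,y)\leq q$, such that for all $x,y,z\in X$ and nonnegative rationals $p,q$: (1) $d(x,y)\leq 0$ iff $x=y$; (2) $d(x,y)\leq q$ implies $d(y,x)\leq q$; (3) $d(x,z)\leq p$ and $d(z,y)\leq q$ imply $d(x,y)\leq p+q$; (4) $d(x,y)\leq p$ iff $d(x,y)\leq q$ for all rationals $q>p$. For $A\subseteq X$, $\operatorname{diam} A\leq q$ means $d(x,y)\leq q$ for all $x,y\in A$. A Cauchy family on $X$ is $F\subseteq\mathcal{P}(X)$ with (i) $S\cap T\neq\emptyset$ for all $S,T\in F$ and (ii) for every rational $\varepsilon>0$ some $S\in F$ has $\operatorname{diam} S\leq\varepsilon$. For Cauchy families $F,F'$ and a nonnegative rational $q$, $d(F,F')\leq q$ means: for every rational $\varepsilon>0$ there exist $S\in F$, $T\in F'$ with $\operatorname{diam} S,\operatorname{diam} T\leq\varepsilon$ and $\operatorname{diam}(S\cup T)\leq q+\varepsilon$. This is a pseudo-premetric; $F\sim F'$ iff $d(F,F')\leq 0$ is an equivalence relation, $\widehat{X}$ is the set of equivalence classes $[F]$, and $\widehat{d}([F],[F'])\leq q$ iff $d(F,F')\leq q$. A map $f:(X,d_X)\to(Y,d_Y)$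 between premetric spaces is an isometric embedding if $d_X(x,x')\leq q \iff d_Y(f(x),f(x'))\leq q$ for all $x,x'\in X$ and nonnegative rationals $q$. A subset $D\subseteq Y$ is dense if for every rational $\varepsilon>0$ and $y\in Y$ there is $z\in D$ with $d_Y(z,y)\leq\varepsilon$. *)

theory Defs
  imports Complex_Main
begin

(* A premetric d is a relation, and d x y q is read "d(x,y) \<le> q".  Nonnegative
   rationals are elements of rat guarded by 0 \<le> q; values of d outside the
   carrier X or at negative q are irrelevant. *)

locale premetric_space =
  fixes X :: "'a set" and d :: "'a \<Rightarrow> 'a \<Rightarrow> rat \<Rightarrow> bool"
  assumes nonempty: "X \<noteq> {}"
    and zero_iff: "\<lbrakk>x \<in> X; y \<in> X\<rbrakk> \<Longrightarrow> d x y 0 \<longleftrightarrow> x = y"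
    and sym: "\<lbrakk>x \<in> X; y \<in> X; 0 \<le> q; d x y q\<rbrakk> \<Longrightarrow> d y x q"
    and triangle: "\<lbrakk>x \<in> X; y \<in> X; z \<in> X; 0 \<le> p; 0 \<le> q; d x z p; d z y q\<rbrakk> \<Longrightarrow> d x y (p + q)"
    and upper_cont: "\<lbrakk>x \<in> X; y \<in> X; 0 \<le> p\<rbrakk> \<Longrightarrow> d x y p \<longleftrightarrow> (\<forall>q>p. d x y q)"

definition diam_le :: "('a \<Rightarrow> 'a \<Rightarrow> rat \<Rightarrow> bool) \<Rightarrow> 'a set \<Rightarrow> rat \<Rightarrow> bool" where
  "diam_le d A q \<longleftrightarrow> (\<forall>x\<in>A. \<forall>y\<in>A. d x y q)"

definition cauchy_family :: "'a set \<Rightarrow> ('a \<Rightarrow> 'a \<Rightarrow> rat \<Rightarrow> bool) \<Rightarrow> 'a set set \<Rightarrow> bool" where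
  "cauchy_family X d F \<longleftrightarrow>
     F \<subseteq> Pow X \<and>
     (\<forall>S\<in>F. \<forall>T\<in>F. S \<inter> T \<noteq> {}) \<and>
     (\<forall>\<epsilon>>0. \<exists>S\<in>F. diam_le d S \<epsilon>)"

definition family_dist :: "('a \<Rightarrow> 'a \<Rightarrow> rat \<Rightarrow> bool) \<Rightarrow> 'a set set \<Rightarrow> 'a set set \<Rightarrow> rat \<Rightarrow> bool" where
  "family_dist d F F' q \<longleftrightarrow>
     (\<forall>\<epsilon>>0. \<exists>S\<in>F. \<exists>T\<in>F'.
        diam_le d S \<epsilon> \<and> diam_le d T \<epsilon> \<and> diam_le d (S \<union> T) (q + \<epsilon>))"

definition cauchy_rel :: "'a set \<Rightarrow> ('a \<Rightarrow> 'a \<Rightarrow> rat \<Rightarrow> bool) \<Rightarrow> ('a set set \<times> 'a set set) set" where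
  "cauchy_rel X d = {(F, F'). cauchy_family X d F \<and> cauchy_family X d F' \<and> family_dist d F F' 0}"

definition completion :: "'a set \<Rightarrow> ('a \<Rightarrow> 'a \<Rightarrow> rat \<Rightarrow> bool) \<Rightarrow> 'a set set set set" where
  "completion X d = {F. cauchy_family X d F} // cauchy_rel X d"

(* Independent of the choice of representatives: see completion_dist_class below. *)
definition completion_dist ::
    "('a \<Rightarrow> 'a \<Rightarrow> rat \<Rightarrow> bool) \<Rightarrow> 'a set set set \<Rightarrow> 'a set set set \<Rightarrow> rat \<Rightarrow> bool" where
  "completion_dist d C C' q \<longleftrightarrow> (\<exists>F\<in>C. \<exists>F'\<in>C'. family_dist d F F' q)"

definition completion_emb :: "'a set \<Rightarrow> ('a \<Rightarrow> 'a \<Rightarrow> rat \<Rightarrow> bool) \<Rightarrow> 'a \<Rightarrow> 'a set set set" where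
  "completion_emb X d x = cauchy_rel X d `` {{{x}}}"

definition isometric_embedding ::
    "'a set \<Rightarrow> ('a \<Rightarrow> 'a \<Rightarrow> rat \<Rightarrow> bool) \<Rightarrow> 'b set \<Rightarrow> ('b \<Rightarrow> 'b \<Rightarrow> rat \<Rightarrow> bool) \<Rightarrow> ('a \<Rightarrow> 'b) \<Rightarrow> bool" where
  "isometric_embedding X dX Y dY f \<longleftrightarrow>
     (\<forall>x\<in>X. f x \<in> Y) \<and>
     (\<forall>x\<in>X. \<forall>x'\<in>X. \<forall>q\<ge>0. dX x x' q \<longleftrightarrow> dY (f x) (f x') q)"

definition dense_subset :: "'a set \<Rightarrow> ('a \<Rightarrow> 'a \<Rightarrow> rat \<Rightarrow> bool) \<Rightarrow> 'a set \<Rightarrow> bool" where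
  "dense_subset Y dY D \<longleftrightarrow> D \<subseteq> Y \<and> (\<forall>\<epsilon>>0. \<forall>y\<in>Y. \<exists>z\<in>D. dY z y \<epsilon>)"

context premetric_space
begin

lemma mono: "\<lbrakk>x \<in> X; y \<in> X; 0 \<le> p; p \<le> q; d x y p\<rbrakk> \<Longrightarrow> d x y q"
  using upper_cont[of x y p] order_le_imp_less_or_eq[of p q] by blast

lemma diam_le_mono: "\<lbrakk>A \<subseteq> X; 0 \<le> p; p \<le> q; diam_le d A p\<rbrakk> \<Longrightarrow> diam_le d A q"
  unfolding diam_le_def by (auto intro: mono[of _ _ p q])

lemma cauchy_familyD:
  assumes "cauchy_family X d F"
  shows "S \<in> F \<Longrightarrow> S \<subseteq> X" and "\<lbrakk>S \<in> F; T \<in> F\<rbrakk> \<Longrightarrow> \<exists>x. x \<in> S \<and> x \<in> T"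
proof -
  have "F \<subseteq> Pow X" and *: "\<forall>S\<in>F. \<forall>T\<in>F. S \<inter> T \<noteq> {}"
    using assms unfolding cauchy_family_def by simp_all
  then show "S \<in> F \<Longrightarrow> S \<subseteq> X" by (simp add: subset_iff)
  show "\<exists>x. x \<in> S \<and> x \<in> T" if "S \<in> F" "T \<in> F"
    using *[rule_format, OF that] by (simp add: disjoint_iff)
qed

lemma family_dist_refl: "cauchy_family X d F \<Longrightarrow> family_dist d F F 0"
  unfolding family_dist_def
proof (intro allI impI)
  fix \<epsilon> :: rat assume "cauchy_family X d F" "0 < \<epsilon>"
  then obtain S where "S \<in> F" "diam_le d S \<epsilon>" unfolding cauchy_family_def by blast
  then show "\<exists>S\<in>F. \<exists>T\<in>F. diam_le d S \<epsilon> \<and> diam_le d T \<epsilon> \<and> diam_le d (S \<union> T) (0 + \<epsilon>)"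
    by (intro bexI[of _ S]) simp_all
qed

lemma family_dist_sym: "family_dist d F G q \<Longrightarrow> family_dist d G F q"
  unfolding family_dist_def
proof (intro allI impI)
  fix \<epsilon> :: rat
  assume "\<forall>\<epsilon>>0. \<exists>S\<in>F. \<exists>T\<in>G. diam_le d S \<epsilon> \<and> diam_le d T \<epsilon> \<and> diam_le d (S \<union> T) (q + \<epsilon>)"
    and "0 < \<epsilon>"
  then obtain S T where "S \<in> F" "T \<in> G" "diam_le d S \<epsilon>" "diam_le d T \<epsilon>" "diam_le d (S \<union> T) (q + \<epsilon>)"
    by blast
  then show "\<exists>S\<in>G. \<exists>T\<in>F. diam_le d S \<epsilon> \<and> diam_le d T \<epsilon> \<and> diam_le d (S \<union> T) (q + \<epsilon>)"
    by (intro bexI[of _ T] bexI[of _ S]) (simp_all add: Un_commute)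
qed

lemma family_dist_triangle:
  assumes F: "cauchy_family X d F" and G: "cauchy_family X d G" and H: "cauchy_family X d H"
    and p: "0 \<le> p" and q: "0 \<le> q"
    and FG: "family_dist d F G p" and GH: "family_dist d G H q"
  shows "family_dist d F H (p + q)"
  unfolding family_dist_def
proof (intro allI impI)
  fix \<epsilon> :: rat assume e: "0 < \<epsilon>"
  define e2 where "e2 = \<epsilon> / 2"
  have e2: "0 < e2" "e2 \<le> \<epsilon>" "\<epsilon> = e2 + e2" using e by (auto simp: e2_def)
  obtain S T where ST: "S \<in> F" "T \<in> G" "diam_le d S e2" "diam_le d (S \<union> T) (p + e2)"
    using FG e2(1) unfolding family_dist_def by blast
  obtain T' U where TU: "T' \<in> G" "U \<in> H" "diam_le d U e2" "diam_le d (T' \<union> U) (q + e2)"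
    using GH e2(1) unfolding family_dist_def by blast
  obtain t where t: "t \<in> T" "t \<in> T'" using cauchy_familyD(2)[OF G ST(2) TU(1)] by blast
  have sub: "S \<subseteq> X" "T \<subseteq> X" "U \<subseteq> X"
    by (rule cauchy_familyD(1)[OF F ST(1)], rule cauchy_familyD(1)[OF G ST(2)],
        rule cauchy_familyD(1)[OF H TU(2)])
  have tX: "t \<in> X" using t sub by blast
  have SU: "d x u (p + q + \<epsilon>)" if "x \<in> S" "u \<in> U" for x u
  proof -
    have "d x t (p + e2)" "d t u (q + e2)"
      using that t ST(4) TU(4) unfolding diam_le_def by blast+
    then have "d x u ((p + e2) + (q + e2))"
      using that sub tX p q e2(1) by (intro triangle[of x u t]) auto
    then show ?thesis by (simp add: e2(3) algebra_simps)
  qed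
  have S: "diam_le d S (p + q + \<epsilon>)" and U: "diam_le d U (p + q + \<epsilon>)"
    using diam_le_mono[OF _ _ _ ST(3)] diam_le_mono[OF _ _ _ TU(3)] sub e2 p q by auto
  have "diam_le d (S \<union> U) (p + q + \<epsilon>)"
    unfolding diam_le_def
  proof (intro ballI)
    fix x y assume xy: "x \<in> S \<union> U" "y \<in> S \<union> U"
    have us: "d u x (p + q + \<epsilon>)" if "x \<in> S" "u \<in> U" for x u
      using sub that p q e by (intro sym[OF _ _ _ SU[OF that]]) auto
    show "d x y (p + q + \<epsilon>)"
      using xy S[unfolded diam_le_def] U[unfolded diam_le_def] SU us by (elim UnE) simp_all
  qed
  moreover have "diam_le d S \<epsilon>" "diam_le d U \<epsilon>"
    using diam_le_mono[OF _ _ _ ST(3)] diam_le_mono[OF _ _ _ TU(3)] sub e2 by auto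
  ultimately show "\<exists>S\<in>F. \<exists>T\<in>H. diam_le d S \<epsilon> \<and> diam_le d T \<epsilon> \<and> diam_le d (S \<union> T) (p + q + \<epsilon>)"
    using ST(1) TU(2) by blast
qed

lemma family_dist_upper_cont:
  assumes F: "cauchy_family X d F" and G: "cauchy_family X d G" and p: "0 \<le> p"
  shows "family_dist d F G p \<longleftrightarrow> (\<forall>q>p. family_dist d F G q)"
proof (intro iffI allI impI)
  fix q assume FG: "family_dist d F G p" and pq: "p < q"
  show "family_dist d F G q"
    unfolding family_dist_def
  proof (intro allI impI)
    fix \<epsilon> :: rat assume e: "0 < \<epsilon>"
    obtain S T where ST: "S \<in> F" "T \<in> G" "diam_le d S \<epsilon>" "diam_le d T \<epsilon>" "diam_le d (S \<union> T) (p + \<epsilon>)"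
      using FG e unfolding family_dist_def by blast
    have "S \<union> T \<subseteq> X"
      using cauchy_familyD(1)[OF F ST(1)] cauchy_familyD(1)[OF G ST(2)] by simp
    then have "diam_le d (S \<union> T) (q + \<epsilon>)"
      using diam_le_mono[OF _ _ _ ST(5)] p pq e by auto
    then show "\<exists>S\<in>F. \<exists>T\<in>G. diam_le d S \<epsilon> \<and> diam_le d T \<epsilon> \<and> diam_le d (S \<union> T) (q + \<epsilon>)"
      using ST by blast
  qed
next
  assume all: "\<forall>q>p. family_dist d F G q"
  show "family_dist d F G p"
    unfolding family_dist_def
  proof (intro allI impI)
    fix \<epsilon> :: rat assume e: "0 < \<epsilon>"
    define e2 where "e2 = \<epsilon> / 2"
    have e2: "0 < e2" "e2 \<le> \<epsilon>" "p + e2 + e2 = p + \<epsilon>" using e by (auto simp: e2_def)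
    have "family_dist d F G (p + e2)" using all e2(1) by simp
    then obtain S T where ST: "S \<in> F" "T \<in> G" "diam_le d S e2" "diam_le d T e2"
        "diam_le d (S \<union> T) (p + \<epsilon>)"
      using e2(1) unfolding family_dist_def e2(3)[symmetric] by blast
    have "S \<subseteq> X" "T \<subseteq> X"
      by (rule cauchy_familyD(1)[OF F ST(1)], rule cauchy_familyD(1)[OF G ST(2)])
    then have "diam_le d S \<epsilon>" "diam_le d T \<epsilon>"
      using diam_le_mono[OF _ _ _ ST(3)] diam_le_mono[OF _ _ _ ST(4)] e2 by auto
    then show "\<exists>S\<in>F. \<exists>T\<in>G. diam_le d S \<epsilon> \<and> diam_le d T \<epsilon> \<and> diam_le d (S \<union> T) (p + \<epsilon>)"
      using ST by blast
  qed
qed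

lemma equiv_cauchy_rel: "equiv {F. cauchy_family X d F} (cauchy_rel X d)"
proof (rule equivI)
  show "cauchy_rel X d \<subseteq> {F. cauchy_family X d F} \<times> {F. cauchy_family X d F}"
    by (auto simp: cauchy_rel_def)
  show "refl_on {F. cauchy_family X d F} (cauchy_rel X d)"
    by (auto simp: refl_on_def cauchy_rel_def family_dist_refl)
  show "Relation.sym (cauchy_rel X d)"
    by (auto simp: sym_def cauchy_rel_def intro: family_dist_sym)
  show "trans (cauchy_rel X d)"
    unfolding trans_def cauchy_rel_def
    using family_dist_triangle[where p = 0 and q = 0, simplified] by blast
qed

lemma completion_dist_class:
  assumes F: "cauchy_family X d F" and G: "cauchy_family X d G" and q: "0 \<le> q"
  shows "completion_dist d (cauchy_rel X d `` {F}) (cauchy_rel X d `` {G}) q \<longleftrightarrow> family_dist d F G q"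
proof
  assume "family_dist d F G q"
  then show "completion_dist d (cauchy_rel X d `` {F}) (cauchy_rel X d `` {G}) q"
    using F G family_dist_refl unfolding completion_dist_def cauchy_rel_def by blast
next
  assume "completion_dist d (cauchy_rel X d `` {F}) (cauchy_rel X d `` {G}) q"
  then obtain F' G' where *: "cauchy_family X d F'" "cauchy_family X d G'"
      "family_dist d F F' 0" "family_dist d G G' 0" "family_dist d F' G' q"
    unfolding completion_dist_def cauchy_rel_def by blast
  have "family_dist d F G' (0 + q)"
    using family_dist_triangle[OF F *(1,2) _ q *(3,5)] by simp
  then have "family_dist d F G (q + 0)"
    using family_dist_triangle[OF F *(2) G q _ _ family_dist_sym[OF *(4)]] by simp
  then show "family_dist d F G q" by simp
qed

lemma cauchy_family_singleton:
  assumes x: "x \<in> X"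
  shows "cauchy_family X d {{x}}"
proof -
  have "d x x \<epsilon>" if "0 < \<epsilon>" for \<epsilon>
    using zero_iff[OF x x] that by (simp add: mono[OF x x order_refl])
  then show ?thesis using x by (simp add: cauchy_family_def diam_le_def)
qed

lemma premetric_space_completion: "premetric_space (completion X d) (completion_dist d)"
proof
  show "completion X d \<noteq> {}"
    using nonempty cauchy_family_singleton by (auto simp: completion_def quotient_def)
next
  fix C C' assume "C \<in> completion X d" "C' \<in> completion X d"
  then obtain F G where F: "cauchy_family X d F" "C = cauchy_rel X d `` {F}"
    and G: "cauchy_family X d G" "C' = cauchy_rel X d `` {G}"
    by (auto simp: completion_def elim!: quotientE)
  note cls = completion_dist_class[OF F(1) G(1), folded F(2) G(2)]
  have "C = C' \<longleftrightarrow> (F, G) \<in> cauchy_rel X d"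
    using eq_equiv_class_iff[OF equiv_cauchy_rel] F G by auto
  then show "completion_dist d C C' 0 \<longleftrightarrow> C = C'"
    using cls[of 0] F(1) G(1) by (auto simp: cauchy_rel_def)
  show "completion_dist d C C' p \<longleftrightarrow> (\<forall>q>p. completion_dist d C C' q)" if "0 \<le> p" for p
    using cls family_dist_upper_cont[OF F(1) G(1) that] that by auto
next
  fix C C' q assume "completion_dist d C C' q"
  then show "completion_dist d C' C q"
    unfolding completion_dist_def using family_dist_sym by blast
next
  fix C C' D p q
  assume CCD: "C \<in> completion X d" "C' \<in> completion X d" "D \<in> completion X d"
    and pq: "(0::rat) \<le> p" "(0::rat) \<le> q"
    and CD: "completion_dist d C D p" and DC: "completion_dist d D C' q"
  from CCD obtain F G H where F: "cauchy_family X d F" "C = cauchy_rel X d `` {F}"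
    and G: "cauchy_family X d G" "C' = cauchy_rel X d `` {G}"
    and H: "cauchy_family X d H" "D = cauchy_rel X d `` {H}"
    by (auto simp: completion_def elim!: quotientE)
  have "family_dist d F G (p + q)"
    using CD DC completion_dist_class[OF F(1) H(1) pq(1)] completion_dist_class[OF H(1) G(1) pq(2)]
      family_dist_triangle[OF F(1) H(1) G(1) pq] F(2) G(2) H(2) by blast
  then show "completion_dist d C C' (p + q)"
    using completion_dist_class[OF F(1) G(1), of "p + q"] F(2) G(2) pq by simp
qed

end

end

theory Submission
  imports Defs
begin

text \<open>By \<open>completion_dist_class\<close>, distances in the completion can be computed on
  any representatives, so both claims are about \<open>family_dist\<close>. Between
  \<open>{{x}}\<close> and \<open>{{y}}\<close> the only members to choose are \<open>{x}\<close>
  and \<open>{y}\<close>; the condition becomes \<open>d x y (q + \<epsilon>)\<close> for all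
  positive \<epsilon>, which upper continuity turns into \<open>d x y q\<close>
  (\<open>family_dist_singletons\<close>). For density, any point of a member of diameter at most
  \<epsilon> of a Cauchy family gives a singleton family within \<epsilon> of it
  (\<open>family_dist_singleton_left\<close>).\<close>

context premetric_space
begin

lemma dist_self: "\<lbrakk>x \<in> X; 0 \<le> q\<rbrakk> \<Longrightarrow> d x x q"
  using zero_iff[of x x] mono[of x x 0 q] by simp

text \<open>By symmetry, only the distances from the new point to \<open>T\<close> need checking;
  this serves the unions \<open>{x} \<union> T\<close> that occur in
  \<open>family_dist\<close>.\<close>

lemma diam_le_insert:
  assumes "x \<in> X" "T \<subseteq> X" "0 \<le> q" "diam_le d T q" "\<And>t. t \<in> T \<Longrightarrow> d x t q"
  shows "diam_le d (insert x T) q"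
proof -
  have "d t x q" if "t \<in> T" for t
    using sym[of x t q] assms that by blast
  then show ?thesis
    using assms dist_self[of x q] unfolding diam_le_def by blast
qed

lemma family_dist_singletons:
  assumes x: "x \<in> X" and y: "y \<in> X" and q: "0 \<le> q"
  shows "family_dist d {{x}} {{y}} q \<longleftrightarrow> d x y q"
proof
  assume *: "family_dist d {{x}} {{y}} q"
  \<comment> \<open>The slack \<open>r - q\<close> makes the bound on the union exactly
    \<open>r\<close>.\<close>
  have "d x y r" if "q < r" for r
    using *[unfolded family_dist_def, rule_format, of "r - q"] that by (simp add: diam_le_def)
  then show "d x y q"
    using upper_cont[OF x y q] by blast
next
  assume "d x y q"
  then have "d x y (q + \<epsilon>)" if "0 < \<epsilon>" for \<epsilon>
    using mono[OF x y q, of "q + \<epsilon>"] that by simp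
  then have "diam_le d {x, y} (q + \<epsilon>)" if "0 < \<epsilon>" for \<epsilon>
    using diam_le_insert[of x "{y}" "q + \<epsilon>"] x y q that dist_self[of y "q + \<epsilon>"]
    by (simp add: diam_le_def)
  then show "family_dist d {{x}} {{y}} q"
    using x y by (simp add: family_dist_def diam_le_def dist_self)
qed

text \<open>Arbitrarily small members \<open>T\<close> of \<open>F\<close> all meet
  \<open>S\<close>, so each of their points is reached from \<open>x\<close> through a common point,
  at cost \<open>p\<close> inside \<open>S\<close> plus the diameter of \<open>T\<close>.\<close>

lemma family_dist_singleton_left:
  assumes F: "cauchy_family X d F" and S: "S \<in> F" "diam_le d S p" and x: "x \<in> S" and p: "0 \<le> p"
  shows "family_dist d {{x}} F p"
  unfolding family_dist_def
proof (intro allI impI)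
  fix \<epsilon> :: rat assume e: "0 < \<epsilon>"
  then obtain T where T: "T \<in> F" "diam_le d T \<epsilon>"
    using F unfolding cauchy_family_def by blast
  obtain s where s: "s \<in> S" "s \<in> T"
    using cauchy_familyD(2)[OF F S(1) T(1)] by blast
  have sub: "S \<subseteq> X" "T \<subseteq> X"
    using cauchy_familyD(1)[OF F] S(1) T(1) by blast+
  have "d x t (p + \<epsilon>)" if "t \<in> T" for t
    using that s x S(2) T(2) sub p e unfolding diam_le_def
    by (intro triangle[of x t s]) auto
  moreover have "diam_le d T (p + \<epsilon>)"
    using diam_le_mono[OF sub(2) _ _ T(2)] p e by simp
  ultimately have "diam_le d ({x} \<union> T) (p + \<epsilon>)"
    using diam_le_insert[of x T "p + \<epsilon>"] x sub p e by auto
  moreover have "diam_le d {x} \<epsilon>"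
    using x sub e dist_self[of x \<epsilon>] by (auto simp: diam_le_def)
  ultimately show "\<exists>S\<in>{{x}}. \<exists>T\<in>F. diam_le d S \<epsilon> \<and> diam_le d T \<epsilon> \<and> diam_le d (S \<union> T) (p + \<epsilon>)"
    using T by blast
qed

lemma completion_emb_in_completion: "x \<in> X \<Longrightarrow> completion_emb X d x \<in> completion X d"
  using cauchy_family_singleton by (simp add: completion_emb_def completion_def quotientI)

lemma isometric_embedding_completion_emb:
  "isometric_embedding X d (completion X d) (completion_dist d) (completion_emb X d)"
  unfolding isometric_embedding_def
  by (simp add: completion_emb_in_completion)
    (simp add: completion_emb_def completion_dist_class cauchy_family_singleton family_dist_singletons)

lemma dense_subset_completion_emb:
  "dense_subset (completion X d) (completion_dist d) (completion_emb X d ` X)"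
  unfolding dense_subset_def
proof (intro conjI allI impI ballI)
  show "completion_emb X d ` X \<subseteq> completion X d"
    using completion_emb_in_completion by blast
next
  fix \<epsilon> :: rat and C assume e: "0 < \<epsilon>" and "C \<in> completion X d"
  then obtain F where F: "cauchy_family X d F" "C = cauchy_rel X d `` {F}"
    by (auto simp: completion_def elim!: quotientE)
  obtain S where S: "S \<in> F" "diam_le d S \<epsilon>"
    using F(1) e unfolding cauchy_family_def by blast
  \<comment> \<open>\<open>S\<close> is nonempty because members of a Cauchy family meet pairwise,
    and \<open>S\<close> may be paired with itself.\<close>
  obtain x where x: "x \<in> S"
    using cauchy_familyD(2)[OF F(1) S(1) S(1)] by blast
  have xX: "x \<in> X"
    using cauchy_familyD(1)[OF F(1) S(1)] x by blast
  have "completion_dist d (completion_emb X d x) C \<epsilon>"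
    using family_dist_singleton_left[OF F(1) S x] completion_dist_class[OF cauchy_family_singleton[OF xX] F(1)] e
    by (simp add: completion_emb_def F(2))
  then show "\<exists>z\<in>completion_emb X d ` X. completion_dist d z C \<epsilon>"
    using xX by blast
qed

end

theorem theorem2p5:
  fixes X :: "'a set" and d :: "'a \<Rightarrow> 'a \<Rightarrow> rat \<Rightarrow> bool"
  assumes "premetric_space X d"
  shows "isometric_embedding X d (completion X d) (completion_dist d) (completion_emb X d) \<and>
         dense_subset (completion X d) (completion_dist d) (completion_emb X d ` X)"
  using premetric_space.isometric_embedding_completion_emb[OF assms]
    premetric_space.dense_subset_completion_emb[OF assms] by blast

end
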